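(* For $f\in L^1_{\mathrm{loc}}(\mathbb{R})$ with $f\notin L^1(\mathbb{R})$ and $T,\Omega>0$, let $f_T=f\cdot\mathbf{1}_{[-T,T]}$, let $$F_T(\omega)=\int_{-\infty}^{\infty}f_T(t)\,e^{-i\omega t}\,dt$$ be the classical Fourier transform of $f_T$, and define the truncated inverse integral $$I_{T,\Omega}(t)=\frac{1}{2\pi}\int_{-\Omega}^{\Omega}F_T(\omega)\,e^{i\omega t}\,d\omega .$$ Then, in general, $$\lim_{T\to\infty}\ \lim_{\Omega\to\infty}I_{T,\Omega}(t)\ \neq\ \lim_{\Omega\to\infty}\ \lim_{T\to\infty}I_{T,\Omega}(t)$$ for pointwise convergence; that is, there exist $f\in L^1_{\mathrm{loc}}(\mathbb{R})$ with $f\notin L^1(\mathbb{R})$ and $t\in\mathbb{R}$ for which the equality of these two iterated limits fails.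
   Context: $\mathbf{1}_{[-T,T]}$ is the indicator function of $[-T,T]$. Iterated limits are read from the inside out (the rightmost limit is taken first), as ordinary pointwise limits of numbers. The equality is also regarded as failing when the left-hand iterated limit exists and the right-hand one does not exist. *)

theory Defs
  imports "HOL-Analysis.Analysis"
begin

definition locally_integrable :: "(real \<Rightarrow> complex) \<Rightarrow> bool" where
  "locally_integrable f \<longleftrightarrow> (\<forall>K. compact K \<longrightarrow> set_integrable lebesgue K f)"

definition truncation :: "(real \<Rightarrow> complex) \<Rightarrow> real \<Rightarrow> real \<Rightarrow> complex" where
  "truncation f T = (\<lambda>t. f t * indicator {-T..T} t)"

definition fourier_transform :: "(real \<Rightarrow> complex) \<Rightarrow> real \<Rightarrow> complex" where
  "fourier_transform g \<omega> = (\<integral>t. g t * exp (- (\<i> * of_real \<omega> * of_real t)) \<partial>lebesgue)"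

definition truncated_inverse :: "(real \<Rightarrow> complex) \<Rightarrow> real \<Rightarrow> real \<Rightarrow> real \<Rightarrow> complex" where
  "truncated_inverse f T \<Omega> t =
     1 / (2 * of_real pi) *
     (LINT \<omega>:{-\<Omega>..\<Omega>}|lebesgue.
        fourier_transform (truncation f T) \<omega> * exp (\<i> * of_real \<omega> * of_real t))"

text \<open>
  The iterated limit of \<open>G x y\<close>, first as \<open>y\<close> and then as \<open>x\<close> tends to infinity, exists
  and equals \<open>L\<close>. The inner limit only has to exist for all sufficiently large \<open>x\<close>, and all
  limits are finite (complex numbers).
\<close>

definition has_iterated_limit :: "(real \<Rightarrow> real \<Rightarrow> complex) \<Rightarrow> complex \<Rightarrow> bool" where
  "has_iterated_limit G L \<longleftrightarrow>
     (\<exists>g. (\<forall>\<^sub>F x in at_top. ((\<lambda>y. G x y) \<longlongrightarrow> g x) at_top) \<and> (g \<longlongrightarrow> L) at_top)"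

end

theory Submission
  imports Defs
begin

text \<open>
  The witness is \<open>f t = t\<^sup>2\<close> at \<open>t = 0\<close>. Exchanging the order of integration in the truncated
  inverse (\<open>truncated_inverse_swap\<close>) replaces the two transforms by integration against the Dirichlet kernel
  \<open>2 sin (\<Omega> s) / s\<close>; one factor \<open>s\<close> of \<open>s\<^sup>2\<close> cancels its denominator, so that everything becomes
  elementary:
  \<open>I\<^sub>T\<^sub>,\<^sub>\<Omega>(0) = (2 / \<pi>) (sin (\<Omega> T) / \<Omega>\<^sup>2 - T cos (\<Omega> T) / \<Omega>)\<close>
  (\<open>truncated_inverse_square\<close>).

  For fixed \<open>T\<close> both terms vanish as \<open>\<Omega>\<close> grows, in accordance with \<open>f 0 = 0\<close>, hence the iterated
  limit with \<open>\<Omega>\<close> innermost is \<open>0\<close>. For fixed \<open>\<Omega>\<close> the boundary term \<open>T cos (\<Omega> T) / \<Omega>\<close> caused by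
  the sharp truncation at \<open>\<plusminus>T\<close> oscillates with an amplitude proportional to \<open>T\<close>, so
  the inner limit of the other iterated limit does not exist for any \<open>\<Omega> > 0\<close>.
\<close>

lemma set_integrable_lebesgue_continuous_on_compact:
  fixes f :: "real \<Rightarrow> complex"
  assumes "compact K" "continuous_on K f"
  shows "set_integrable lebesgue K f"
proof -
  have "integrable lborel (\<lambda>x. indicator K x *\<^sub>R f x)"
    using borel_integrable_compact[OF assms] by simp
  then show ?thesis
    unfolding set_integrable_def by (subst integrable_completion) auto
qed

lemma set_lebesgue_integral_continuous_on_Icc:
  fixes f :: "real \<Rightarrow> complex"
  assumes "continuous_on {a..b} f"
  shows "(LINT x:{a..b}|lebesgue. f x) = integral {a..b} f"
  by (rule set_lebesgue_integral_eq_integral(2))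
     (simp add: set_integrable_lebesgue_continuous_on_compact assms)

lemma fourier_transform_truncation:
  assumes "continuous_on UNIV f"
  shows "fourier_transform (truncation f T) \<omega> =
           integral {-T..T} (\<lambda>s. f s * exp (- (\<i> * of_real \<omega> * of_real s)))"
proof -
  have f: "continuous_on {-T..T} f"
    using assms continuous_on_subset by blast
  have "fourier_transform (truncation f T) \<omega> =
          (LINT s:{-T..T}|lebesgue. f s * exp (- (\<i> * of_real \<omega> * of_real s)))"
    unfolding fourier_transform_def truncation_def set_lebesgue_integral_def
    by (rule Bochner_Integration.integral_cong) (auto simp: indicator_def)
  then show ?thesis
    by (simp add: set_lebesgue_integral_continuous_on_Icc f continuous_intros)
qed

text \<open>
  The integrand is jointly continuous on the compact rectangle \<open>[-\<Omega>, \<Omega>] \<times> [-T, T]\<close>,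
  so the two integrations may be exchanged.
\<close>

lemma truncated_inverse_swap:
  assumes f: "continuous_on UNIV f"
  shows "truncated_inverse f T \<Omega> t =
           1 / (2 * of_real pi) *
           integral {-T..T} (\<lambda>s. f s * integral {-\<Omega>..\<Omega>} (\<lambda>\<omega>. exp (\<i> * of_real (t - s) * of_real \<omega>)))"
proof -
  define h where
    "h \<omega> s = f s * exp (- (\<i> * of_real \<omega> * of_real s)) * exp (\<i> * of_real \<omega> * of_real t)" for \<omega> s
  have h_eq: "h \<omega> s = f s * exp (\<i> * of_real (t - s) * of_real \<omega>)" for \<omega> s
    by (simp add: h_def mult.assoc flip: exp_add) (simp add: algebra_simps)
  have cont: "continuous_on (cbox (-\<Omega>, -T) (\<Omega>, T)) (\<lambda>(\<omega>, s). h \<omega> s)"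
    unfolding h_def case_prod_beta
    by (intro continuous_intros continuous_on_compose2[OF f]) auto
  have inner: "fourier_transform (truncation f T) \<omega> * exp (\<i> * of_real \<omega> * of_real t)
                 = integral {-T..T} (h \<omega>)" for \<omega>
    by (simp add: fourier_transform_truncation[OF f] h_def[abs_def])
  have "continuous_on {-\<Omega>..\<Omega>} (\<lambda>\<omega>. integral (cbox (-T) T) (h \<omega>))"
    using cont by (intro integral_continuous_on_param) (simp add: cbox_Pair_eq)
  then have "(LINT \<omega>:{-\<Omega>..\<Omega>}|lebesgue. integral {-T..T} (h \<omega>))
               = integral {-\<Omega>..\<Omega>} (\<lambda>\<omega>. integral {-T..T} (h \<omega>))"
    by (simp add: set_lebesgue_integral_continuous_on_Icc)
  also have "\<dots> = integral {-T..T} (\<lambda>s. integral {-\<Omega>..\<Omega>} (\<lambda>\<omega>. h \<omega> s))"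
    using integral_swap_continuous[OF cont] by simp
  finally show ?thesis
    by (simp add: truncated_inverse_def inner h_eq)
qed

text \<open>
  This is the Dirichlet kernel multiplied by \<open>s\<close>: without division the closed form is
  valid at \<open>s = 0\<close> too, and \<open>s\<^sup>2\<close> supplies the factor.
\<close>

lemma integral_exp_symmetric:
  fixes s \<Omega> :: real
  assumes "\<Omega> \<ge> 0"
  shows "of_real s * integral {-\<Omega>..\<Omega>} (\<lambda>\<omega>. exp (- (\<i> * of_real s * of_real \<omega>)))
           = of_real (2 * sin (\<Omega> * s))"
proof (cases "s = 0")
  case False
  have "((\<lambda>\<omega>. exp (- (\<i> * of_real s * of_real \<omega>))) has_integral
          \<i> / of_real s * exp (- (\<i> * of_real s * of_real \<Omega>))
        - \<i> / of_real s * exp (- (\<i> * of_real s * of_real (-\<Omega>)))) {-\<Omega>..\<Omega>}"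
    using False assms
    by (intro fundamental_theorem_of_calculus)
       (auto intro!: derivative_eq_intros has_vector_derivative_real_field)
  moreover have "\<i> * exp (- (\<i> * of_real s * of_real \<Omega>))
        - \<i> * exp (- (\<i> * of_real s * of_real (-\<Omega>))) = of_real (2 * sin (\<Omega> * s))"
    by (simp add: complex_eq_iff Re_exp Im_exp mult.commute)
  ultimately show ?thesis
    using False by (simp add: integral_unique right_diff_distrib)
qed simp

lemma integral_mult_sin_symmetric:
  fixes \<Omega> T :: real
  assumes "\<Omega> > 0" "T \<ge> 0"
  shows "integral {-T..T} (\<lambda>s. s * sin (\<Omega> * s))
           = 2 * (sin (\<Omega> * T) / \<Omega>\<^sup>2 - T * cos (\<Omega> * T) / \<Omega>)"
proof -
  let ?P = "\<lambda>s. sin (\<Omega> * s) / \<Omega>\<^sup>2 - s * cos (\<Omega> * s) / \<Omega>"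
  have "((\<lambda>s. s * sin (\<Omega> * s)) has_integral (?P T - ?P (-T))) {-T..T}"
    using assms
    by (intro fundamental_theorem_of_calculus)
       (auto intro!: derivative_eq_intros
             simp: field_simps power2_eq_square simp flip: has_real_derivative_iff_has_vector_derivative)
  then show ?thesis
    by (simp add: integral_unique)
qed

lemma truncated_inverse_square:
  assumes "\<Omega> > 0" "T \<ge> 0"
  shows "truncated_inverse (\<lambda>s. of_real (s\<^sup>2)) T \<Omega> 0 =
           of_real (2 / pi * (sin (\<Omega> * T) / \<Omega>\<^sup>2 - T * cos (\<Omega> * T) / \<Omega>))"
proof -
  have kernel: "of_real (s\<^sup>2) * integral {-\<Omega>..\<Omega>} (\<lambda>\<omega>. exp (\<i> * of_real (0 - s) * of_real \<omega>))
          = complex_of_real (2 * (s * sin (\<Omega> * s)))" for s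
    using integral_exp_symmetric[of \<Omega> s] assms
    by (simp add: power2_eq_square mult.assoc)
  have cont: "continuous_on UNIV (\<lambda>s. complex_of_real (s\<^sup>2))"
    by (intro continuous_intros)
  have "(\<lambda>s. 2 * (s * sin (\<Omega> * s))) integrable_on {-T..T}"
    by (intro integrable_continuous_interval continuous_intros)
  then have "integral {-T..T} (\<lambda>s. complex_of_real (2 * (s * sin (\<Omega> * s))))
               = of_real (integral {-T..T} (\<lambda>s. 2 * (s * sin (\<Omega> * s))))"
    using has_integral_of_real integral_unique integrable_integral by blast
  also have "\<dots> = of_real (4 * (sin (\<Omega> * T) / \<Omega>\<^sup>2 - T * cos (\<Omega> * T) / \<Omega>))"
    by (simp add: integral_mult_sin_symmetric[OF assms])
  finally show ?thesis
    by (simp only: truncated_inverse_swap[OF cont] kernel) (simp add: field_simps)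
qed

lemma truncated_inverse_square_tendsto_0:
  assumes "T \<ge> 0"
  shows "((\<lambda>\<Omega>. truncated_inverse (\<lambda>s. of_real (s\<^sup>2)) T \<Omega> 0) \<longlongrightarrow> 0) at_top"
proof -
  have inv: "((\<lambda>\<Omega>. inverse \<Omega>) \<longlongrightarrow> (0::real)) at_top"
    by (rule tendsto_inverse_0_at_top) (rule filterlim_ident)
  have damped: "((\<lambda>\<Omega>. a \<Omega> * b \<Omega>) \<longlongrightarrow> 0) at_top"
    if "(a \<longlongrightarrow> 0) at_top" "\<And>\<Omega>. \<bar>b \<Omega>\<bar> \<le> 1" for a b :: "real \<Rightarrow> real"
    using that(2)
    by (intro Lim_null_comparison[OF _ tendsto_rabs_zero[OF that(1)]] always_eventually allI)
       (simp add: abs_mult mult_left_le)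
  have S: "((\<lambda>\<Omega>. inverse \<Omega> * inverse \<Omega> * sin (\<Omega> * T)) \<longlongrightarrow> 0) at_top"
    by (intro damped tendsto_mult_zero inv) simp
  have C: "((\<lambda>\<Omega>. inverse \<Omega> * cos (\<Omega> * T)) \<longlongrightarrow> 0) at_top"
    by (intro damped inv) simp
  have "((\<lambda>\<Omega>. 2 / pi * (inverse \<Omega> * inverse \<Omega> * sin (\<Omega> * T) - T * (inverse \<Omega> * cos (\<Omega> * T))))
           \<longlongrightarrow> 2 / pi * (0 - T * 0)) at_top"
    by (intro tendsto_intros S C)
  then have "((\<lambda>\<Omega>. complex_of_real (2 / pi * (sin (\<Omega> * T) / \<Omega>\<^sup>2 - T * cos (\<Omega> * T) / \<Omega>)))
           \<longlongrightarrow> complex_of_real 0) at_top"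
    by (intro tendsto_of_real) (simp add: field_simps power2_eq_square)
  then show ?thesis
    unfolding of_real_0
    by (rule Lim_transform_eventually)
       (use eventually_gt_at_top[of "0::real"] in \<open>eventually_elim, simp only: truncated_inverse_square assms\<close>)
qed

text \<open>
  Along \<open>T = 2 \<pi> n / \<Omega>\<close> the sine vanishes and the cosine equals \<open>1\<close>, so the values
  tend to infinity in modulus.
\<close>

lemma truncated_inverse_square_diverges:
  assumes "\<Omega> > 0"
  shows "\<not> ((\<lambda>T. truncated_inverse (\<lambda>s. of_real (s\<^sup>2)) T \<Omega> 0) \<longlongrightarrow> l) at_top"
proof
  assume lim: "((\<lambda>T. truncated_inverse (\<lambda>s. of_real (s\<^sup>2)) T \<Omega> 0) \<longlongrightarrow> l) at_top"
  define T where "T n = 2 * pi / \<Omega> * real n" for n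
  have "filterlim T at_top sequentially"
    unfolding T_def using assms
    by (intro filterlim_tendsto_pos_mult_at_top[OF tendsto_const _ filterlim_real_sequentially]) simp
  with lim have conv: "(\<lambda>n. truncated_inverse (\<lambda>s. of_real (s\<^sup>2)) (T n) \<Omega> 0) \<longlonglongrightarrow> l"
    by (rule filterlim_compose)
  have val: "truncated_inverse (\<lambda>s. of_real (s\<^sup>2)) (T n) \<Omega> 0 = of_real (- 4 / \<Omega>\<^sup>2 * real n)" for n
  proof -
    have arg: "\<Omega> * T n = real n * (2 * pi)" and pos: "T n \<ge> 0"
      using assms by (simp_all add: T_def)
    have "sin (real n * (2 * pi)) = 0" "cos (real n * (2 * pi)) = 1"
      using sin_npi[of "2 * n"] cos_npi[of "2 * n"] by (simp_all add: mult_ac)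
    then have "truncated_inverse (\<lambda>s. of_real (s\<^sup>2)) (T n) \<Omega> 0
        = of_real (2 / pi * (0 / \<Omega>\<^sup>2 - T n * 1 / \<Omega>))"
      by (simp only: truncated_inverse_square[OF assms pos] arg)
    also have "2 / pi * (0 / \<Omega>\<^sup>2 - T n * 1 / \<Omega>) = - 4 / \<Omega>\<^sup>2 * real n"
      using assms by (simp add: T_def field_simps power2_eq_square)
    finally show ?thesis .
  qed
  have "filterlim (\<lambda>n. 4 / \<Omega>\<^sup>2 * real n) at_top sequentially"
    using assms
    by (intro filterlim_tendsto_pos_mult_at_top[OF tendsto_const _ filterlim_real_sequentially]) simp
  then have "filterlim (\<lambda>n. complex_of_real (- 4 / \<Omega>\<^sup>2 * real n)) at_infinity sequentially"
    by (intro filterlim_norm_at_top_imp_at_infinity) (simp add: norm_mult norm_divide norm_power)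
  with conv show False
    using not_tendsto_and_filterlim_at_infinity[OF sequentially_bot] unfolding val by blast
qed

lemma locally_integrable_continuous:
  assumes "continuous_on UNIV f"
  shows "locally_integrable f"
  unfolding locally_integrable_def
  using assms continuous_on_subset set_integrable_lebesgue_continuous_on_compact by blast

lemma square_not_integrable: "\<not> integrable lebesgue (\<lambda>s. complex_of_real (s\<^sup>2))"
proof
  assume int: "integrable lebesgue (\<lambda>s. complex_of_real (s\<^sup>2))"
  \<comment> \<open>On \<open>[1, \<infinity>)\<close> the integrand is at least \<open>1\<close>, so its integral would bound the length of every
    interval \<open>[1, 1 + n]\<close>.\<close>
  have "real n \<le> (\<integral>s. norm (complex_of_real (s\<^sup>2)) \<partial>lebesgue)" for n :: nat
  proof -
    have "(\<integral>s. indicator {1..1 + real n} s \<partial>lebesgue)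
            \<le> (\<integral>s. norm (complex_of_real (s\<^sup>2)) \<partial>lebesgue)"
    proof (rule integral_mono)
      show "integrable lebesgue (indicator {1..1 + real n} :: real \<Rightarrow> real)"
        by (intro integrable_real_indicator) auto
      show "integrable lebesgue (\<lambda>s. norm (complex_of_real (s\<^sup>2)))"
        using int by (rule integrable_norm)
      show "indicator {1..1 + real n} s \<le> norm (complex_of_real (s\<^sup>2))" for s
        by (auto simp: indicator_def norm_power intro!: one_le_power)
    qed
    then show ?thesis by simp
  qed
  then show False
    using reals_Archimedean2 not_le by blast
qed

theorem theorem3p4:
  "\<exists>(f :: real \<Rightarrow> complex) (t :: real).
     locally_integrable f \<and> \<not> integrable lebesgue f \<and>
     (\<exists>L. has_iterated_limit (\<lambda>T \<Omega>. truncated_inverse f T \<Omega> t) L \<and>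
          ((\<exists>R. has_iterated_limit (\<lambda>\<Omega> T. truncated_inverse f T \<Omega> t) R \<and> L \<noteq> R) \<or>
           \<not> (\<exists>R. has_iterated_limit (\<lambda>\<Omega> T. truncated_inverse f T \<Omega> t) R)))"
proof -
  let ?f = "\<lambda>s. complex_of_real (s\<^sup>2)"
  have "locally_integrable ?f"
    by (intro locally_integrable_continuous continuous_intros)
  moreover have "has_iterated_limit (\<lambda>T \<Omega>. truncated_inverse ?f T \<Omega> 0) 0"
    unfolding has_iterated_limit_def
    by (intro exI[of _ "\<lambda>_. 0"] conjI tendsto_const
          eventually_mono[OF eventually_ge_at_top[of 0]] truncated_inverse_square_tendsto_0)
  moreover have "\<not> has_iterated_limit (\<lambda>\<Omega> T. truncated_inverse ?f T \<Omega> 0) R" for R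
  proof
    assume "has_iterated_limit (\<lambda>\<Omega> T. truncated_inverse ?f T \<Omega> 0) R"
    then obtain g where
      "\<forall>\<^sub>F \<Omega> in at_top. ((\<lambda>T. truncated_inverse ?f T \<Omega> 0) \<longlongrightarrow> g \<Omega>) at_top"
      unfolding has_iterated_limit_def by blast
    then have "\<forall>\<^sub>F \<Omega> :: real in at_top. False"
      using eventually_gt_at_top[of "0::real"]
      by eventually_elim (use truncated_inverse_square_diverges in blast)
    then show False by simp
  qed
  ultimately show ?thesis
    using square_not_integrable by blast
qed

end
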